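(* For homotopy of Gauss words, the groups $G_1$, $G_2$ and $G_3$ are all isomorphic to $\mathbb{Z}$. Thus there are no finite type invariants of degree $1$, $2$ or $3$ for homotopy of Gauss words.
   Context: A Gauss word is a finite word (possibly empty) in which every letter that occurs occurs exactly twice. Two Gauss words are isomorphic if a bijection of their letter sets carries one to the other letterwise. The rank of a Gauss word is its number of distinct letters. Homotopy of Gauss words is the equivalence relation generated by isomorphism and the moves (in both directions) $xAAy\leftrightarrow xy$, $xAByBAz\leftrightarrow xyz$, $xAByACzBCt\leftrightarrow xBAyCAzCBt$, where $x,y,z,t$ are arbitrary sequences of letters such that both sides are Gauss words. (This is the nanoword homotopy with $\alpha=\{a\}$, $\tau=\mathrm{id}$, $S=\{(a,a,a)\}$.) Finite type invariants. A homotopy invariant is a function on homotopy classes of Gauss words with values in an additive abelian group, extended linearly to the free abelian group on these classes. A Gauss word with a letter $A$ marked as a semi-letter $\dot A$ denotes $x\dot Ay\dot Az=xAyAz-xyz$, applied recursively for several semi-letters. A homotopy invariant $v$ is a finite type invariant if there is an integer $n$ such that $v$ vanishes on every Gauss word with more than $n$ semi-letters; the least such $n\ge0$ is the degree of $v$. The group $G_n$ is the quotient of the free abelian group on isomorphism classes of Gauss words by the relations ($x,y,z,t$ arbitrary sequences of letters such that all terms are Gauss words): (1) $xAAy=0$; (2) $xAByBAz+xAyAz+xByBz=0$; (3) $xAByACzBCt+xAByAzBt+xAyACzCt+xByCzBCt=xBAyCAzCBt+xBAyAzBt+xAyCAzCt+xByCzCBt$; (4) $p=0$ for every Gauss word $p$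 of rank greater than $n$. *)

theory Defs
  imports "HOL-Algebra.Algebra"
begin

section \<open>Gauss words\<close>

text \<open>Letters are natural numbers. Every Gauss word is isomorphic to one over this countable
  alphabet, and the alphabet always offers letters not occurring in a given word.\<close>

type_synonym word = "nat list"

definition gauss_word :: "word \<Rightarrow> bool" where
  "gauss_word w \<longleftrightarrow> (\<forall>a\<in>set w. count_list w a = 2)"

definition gauss_rank :: "word \<Rightarrow> nat" where
  "gauss_rank w = card (set w)"

definition word_iso :: "word \<Rightarrow> word \<Rightarrow> bool" where
  "word_iso u v \<longleftrightarrow> (\<exists>f. bij_betw f (set u) (set v) \<and> v = map f u)"

definition iso_rel :: "(word \<times> word) set" where
  "iso_rel = {(u, v). gauss_word u \<and> gauss_word v \<and> word_iso u v}"

section \<open>Homotopy\<close>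

text \<open>The requirement that both sides are Gauss words forces \<open>A\<close>, \<open>B\<close>, \<open>C\<close> to be pairwise distinct
  and not to occur in \<open>x\<close>, \<open>y\<close>, \<open>z\<close>, \<open>t\<close>.\<close>

inductive homotopy_step :: "word \<Rightarrow> word \<Rightarrow> bool" where
  iso: "gauss_word u \<Longrightarrow> gauss_word v \<Longrightarrow> word_iso u v \<Longrightarrow> homotopy_step u v"
| H1: "gauss_word (x @ [A, A] @ y) \<Longrightarrow> gauss_word (x @ y) \<Longrightarrow>
    homotopy_step (x @ [A, A] @ y) (x @ y)"
| H2: "gauss_word (x @ [A, B] @ y @ [B, A] @ z) \<Longrightarrow> gauss_word (x @ y @ z) \<Longrightarrow>
    homotopy_step (x @ [A, B] @ y @ [B, A] @ z) (x @ y @ z)"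
| H3: "gauss_word (x @ [A, B] @ y @ [A, C] @ z @ [B, C] @ t) \<Longrightarrow>
    gauss_word (x @ [B, A] @ y @ [C, A] @ z @ [C, B] @ t) \<Longrightarrow>
    homotopy_step (x @ [A, B] @ y @ [A, C] @ z @ [B, C] @ t)
                  (x @ [B, A] @ y @ [C, A] @ z @ [C, B] @ t)"

definition homotopy_rel :: "(word \<times> word) set" where
  "homotopy_rel = {(u, v). gauss_word u \<and> gauss_word v \<and> equivclp homotopy_step u v}"

definition homotopy_classes :: "word set set" where
  "homotopy_classes = {w. gauss_word w} // homotopy_rel"

definition homotopy_class :: "word \<Rightarrow> word set" where
  "homotopy_class w = homotopy_rel `` {w}"

section \<open>Finite type invariants\<close>

definition homotopy_invariant :: "('b, 'm) monoid_scheme \<Rightarrow> (word set \<Rightarrow> 'b) \<Rightarrow> bool" where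
  "homotopy_invariant A v \<longleftrightarrow> v \<in> homotopy_classes \<rightarrow> carrier A"

text \<open>The linear extension of \<open>v\<close> to finite integral combinations of homotopy classes; the
  abelian group \<open>A\<close> is written multiplicatively.\<close>

definition linear_extension ::
    "('b, 'm) monoid_scheme \<Rightarrow> (word set \<Rightarrow> 'b) \<Rightarrow> (word set \<Rightarrow>\<^sub>0 int) \<Rightarrow> 'b" where
  "linear_extension A v c =
    finprod A (\<lambda>k. v k [^]\<^bsub>A\<^esub> Poly_Mapping.lookup c k) (Poly_Mapping.keys c)"

text \<open>A Gauss word with semi-letters is given by the underlying word and a list of its
  semi-letters; \<open>semi_word As w\<close> is the combination of homotopy classes it denotes.
  The order in which the semi-letters are resolved does not affect the result.\<close>

fun semi_word :: "nat list \<Rightarrow> word \<Rightarrow> (word set \<Rightarrow>\<^sub>0 int)" where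
  "semi_word [] w = frag_of (homotopy_class w)"
| "semi_word (A # As) w = semi_word As w - semi_word As (removeAll A w)"

definition vanishes_above ::
    "('b, 'm) monoid_scheme \<Rightarrow> (word set \<Rightarrow> 'b) \<Rightarrow> nat \<Rightarrow> bool" where
  "vanishes_above A v n \<longleftrightarrow>
    (\<forall>w As. gauss_word w \<and> distinct As \<and> set As \<subseteq> set w \<and> length As > n \<longrightarrow>
      linear_extension A v (semi_word As w) = \<one>\<^bsub>A\<^esub>)"

definition finite_type_invariant ::
    "('b, 'm) monoid_scheme \<Rightarrow> (word set \<Rightarrow> 'b) \<Rightarrow> bool" where
  "finite_type_invariant A v \<longleftrightarrow> homotopy_invariant A v \<and> (\<exists>n. vanishes_above A v n)"

definition invariant_degree ::
    "('b, 'm) monoid_scheme \<Rightarrow> (word set \<Rightarrow> 'b) \<Rightarrow> nat" where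
  "invariant_degree A v = (LEAST n. vanishes_above A v n)"

section \<open>The groups \<open>G\<^sub>n\<close>\<close>

definition iso_classes :: "word set set" where
  "iso_classes = {w. gauss_word w} // iso_rel"

definition gen :: "word \<Rightarrow> (word set \<Rightarrow>\<^sub>0 int)" where
  "gen w = frag_of (iso_rel `` {w})"

text \<open>An equation \<open>l = r\<close> between combinations of Gauss words is imposed through the
  relator \<open>l - r\<close>.\<close>

inductive_set relators :: "nat \<Rightarrow> (word set \<Rightarrow>\<^sub>0 int) set" for n :: nat where
  R1: "gauss_word (x @ [A, A] @ y) \<Longrightarrow> gen (x @ [A, A] @ y) \<in> relators n"
| R2: "\<forall>w \<in> {x @ [A, B] @ y @ [B, A] @ z,
             x @ [A] @ y @ [A] @ z,
             x @ [B] @ y @ [B] @ z}. gauss_word w \<Longrightarrow>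
    gen (x @ [A, B] @ y @ [B, A] @ z)
      + gen (x @ [A] @ y @ [A] @ z)
      + gen (x @ [B] @ y @ [B] @ z) \<in> relators n"
| R3: "\<forall>w \<in> {x @ [A, B] @ y @ [A, C] @ z @ [B, C] @ t,
             x @ [A, B] @ y @ [A] @ z @ [B] @ t,
             x @ [A] @ y @ [A, C] @ z @ [C] @ t,
             x @ [B] @ y @ [C] @ z @ [B, C] @ t,
             x @ [B, A] @ y @ [C, A] @ z @ [C, B] @ t,
             x @ [B, A] @ y @ [A] @ z @ [B] @ t,
             x @ [A] @ y @ [C, A] @ z @ [C] @ t,
             x @ [B] @ y @ [C] @ z @ [C, B] @ t}. gauss_word w \<Longrightarrow>
    (gen (x @ [A, B] @ y @ [A, C] @ z @ [B, C] @ t)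
      + gen (x @ [A, B] @ y @ [A] @ z @ [B] @ t)
      + gen (x @ [A] @ y @ [A, C] @ z @ [C] @ t)
      + gen (x @ [B] @ y @ [C] @ z @ [B, C] @ t))
    - (gen (x @ [B, A] @ y @ [C, A] @ z @ [C, B] @ t)
      + gen (x @ [B, A] @ y @ [A] @ z @ [B] @ t)
      + gen (x @ [A] @ y @ [C, A] @ z @ [C] @ t)
      + gen (x @ [B] @ y @ [C] @ z @ [C, B] @ t)) \<in> relators n"
| R4: "gauss_word w \<Longrightarrow> gauss_rank w > n \<Longrightarrow> gen w \<in> relators n"

definition gauss_group :: "nat \<Rightarrow> (word set \<Rightarrow>\<^sub>0 int) set monoid" where
  "gauss_group n =
    free_Abelian_group iso_classes Mod
      generate (free_Abelian_group iso_classes) (relators n)"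

end

theory Submission
  imports Defs
begin

text \<open>
  The coefficient of the empty word is a homomorphism \<open>G\<^sub>n \<rightarrow> \<int>\<close>, because no relation involves the
  empty word. To see that it is injective for \<open>n \<le> 3\<close>, it suffices that every non-empty Gauss word
  is zero in \<open>G\<^sub>n\<close>. Words of rank above \<open>n\<close> and words with two equal neighbours are zero by
  definition, and only six isomorphism classes of rank at most 3 remain
  (\<open>gauss_word_rank_le_3_cases\<close>). The relations of \<open>G\<^sub>3\<close> between words of rank 4, truncated to
  their terms of rank 3, together with the relations between words of rank 3, form a linear system
  that forces these six to vanish (\<open>short_free_gen_in_relator_span\<close>). These arguments cover
  \<open>n < 3\<close> as well, since a smaller rank bound only adds relations.

  For the second claim, make all letters of a word semi-letters; the resulting combination of
  homotopy classes is called its symbol. Symbols satisfy the first three relations of \<open>G\<^sub>n\<close>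
  exactly (\<open>symbol_R1\<close>, \<open>symbol_R2\<close>, \<open>symbol_R3\<close>), and an invariant of degree \<open>n\<close> kills the symbols of
  words of rank above \<open>n\<close>. Hence, composed with the symbol, it factors through \<open>G\<^sub>n\<close>, and for
  \<open>n \<le> 3\<close> it kills the symbols of all non-empty words (\<open>symbol_in_kernel\<close>). A word with at least one
  semi-letter is a sum of such symbols, so the invariant vanishes on it and has degree 0
  (\<open>vanishes_above_zero\<close>).
\<close>

section \<open>Gauss words up to isomorphism\<close>

lemma gauss_word_cong_mset: "mset u = mset v \<Longrightarrow> gauss_word u = gauss_word v"
  unfolding gauss_word_def by (metis count_mset set_mset_mset)

lemma gauss_word_removeAll: "gauss_word w \<Longrightarrow> gauss_word (removeAll D w)"
proof -
  have "count_list (removeAll D w) a = count_list w a" if "a \<noteq> D" for a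
    using that by (induction w) auto
  then show "gauss_word w \<Longrightarrow> gauss_word (removeAll D w)"
    by (auto simp: gauss_word_def)
qed

lemma word_iso_map: "inj_on f (set w) \<Longrightarrow> word_iso w (map f w)"
  unfolding word_iso_def by (auto simp: bij_betw_def)

lemma equiv_iso_rel: "equiv {w. gauss_word w} iso_rel"
proof (rule equivI)
  show "iso_rel \<subseteq> {w. gauss_word w} \<times> {w. gauss_word w}"
    by (auto simp: iso_rel_def)
  show "refl_on {w. gauss_word w} iso_rel"
    by (auto simp: refl_on_def iso_rel_def word_iso_def intro!: exI[of _ id])
  show "sym iso_rel"
  proof (rule symI)
    fix u v assume "(u, v) \<in> iso_rel"
    then obtain f where f: "gauss_word u" "gauss_word v" "bij_betw f (set u) (set v)" "v = map f u"
      by (auto simp: iso_rel_def word_iso_def)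
    have "map (inv_into (set u) f) v = u"
      using f by (auto simp: bij_betw_def intro!: map_idI)
    then show "(v, u) \<in> iso_rel"
      using f bij_betw_inv_into[OF f(3)] unfolding iso_rel_def word_iso_def by auto
  qed
  show "trans iso_rel"
  proof (rule transI)
    fix u v w assume "(u, v) \<in> iso_rel" "(v, w) \<in> iso_rel"
    then obtain f g where "gauss_word u" "gauss_word w" "bij_betw f (set u) (set v)" "v = map f u"
        "bij_betw g (set v) (set w)" "w = map g v"
      by (auto simp: iso_rel_def word_iso_def)
    then show "(u, w) \<in> iso_rel"
      unfolding iso_rel_def word_iso_def
      by (auto intro!: exI[of _ "g \<circ> f"] bij_betw_trans)
  qed
qed

lemma gauss_word_map:
  assumes "inj_on f (set w)" "gauss_word w" shows "gauss_word (map f w)"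
proof -
  have "count_list (map f w) (f a) = count_list w a" if "inj_on f (insert a (set w))" for a
    using that by (induction w) (auto simp: inj_on_def)
  then show ?thesis
    using assms by (auto simp: gauss_word_def insert_absorb simp del: inj_on_insert)
qed

lemma gen_map:
  assumes "inj_on f (set w)" "gauss_word w"
  shows "gen (map f w) = gen w"
proof -
  have "(w, map f w) \<in> iso_rel"
    using assms gauss_word_map word_iso_map by (auto simp: iso_rel_def)
  then show ?thesis
    unfolding gen_def by (metis equiv_class_eq equiv_iso_rel)
qed

text \<open>The form in which isomorphism invariance enters the calculations: a word is a pattern over
  \<open>0, 1, 2, \<dots>\<close> whose entries index a list of distinct letters.\<close>

lemma gen_pattern:
  assumes "distinct L" "gauss_word p" "set p \<subseteq> {..<length L}"
  shows "gen (map ((!) L) p) = gen p"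
proof (rule gen_map)
  show "inj_on ((!) L) (set p)"
    using assms(1,3) by (meson inj_on_nth inj_on_subset lessThan_iff subset_iff)
qed (fact assms)

section \<open>The subgroup of relations\<close>

definition relator_span :: "nat \<Rightarrow> (word set \<Rightarrow>\<^sub>0 int) set" where
  "relator_span n = generate (free_Abelian_group iso_classes) (relators n)"

lemma gen_in_carrier: "gauss_word w \<Longrightarrow> gen w \<in> carrier (free_Abelian_group iso_classes)"
  by (auto simp: gen_def iso_classes_def quotient_def)

lemma relators_in_carrier: "relators n \<subseteq> carrier (free_Abelian_group iso_classes)"
proof
  interpret group "free_Abelian_group iso_classes" by simp
  have add: "a + b \<in> carrier (free_Abelian_group iso_classes)"
    if "a \<in> carrier (free_Abelian_group iso_classes)" "b \<in> carrier (free_Abelian_group iso_classes)" for a b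
    using m_closed[OF that] by simp
  have diff: "a - b \<in> carrier (free_Abelian_group iso_classes)"
    if "a \<in> carrier (free_Abelian_group iso_classes)" "b \<in> carrier (free_Abelian_group iso_classes)" for a b
    using that keys_diff[of a b] by auto
  fix r assume "r \<in> relators n"
  then show "r \<in> carrier (free_Abelian_group iso_classes)"
    by induction (intro add diff gen_in_carrier; simp)+
qed

lemma subgroup_relator_span: "subgroup (relator_span n) (free_Abelian_group iso_classes)"
  unfolding relator_span_def
  by (rule group.generate_is_subgroup) (simp_all add: relators_in_carrier del: carrier_free_Abelian_group_iff)

lemma relator_span_base: "r \<in> relators n \<Longrightarrow> r \<in> relator_span n"
  unfolding relator_span_def by (rule generate.incl)

lemma relator_span_zero: "0 \<in> relator_span n"
  using subgroup.one_closed[OF subgroup_relator_span] by simp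

lemma relator_span_diff:
  assumes "a \<in> relator_span n" "b \<in> relator_span n" shows "a - b \<in> relator_span n"
proof -
  have "Poly_Mapping.keys b \<subseteq> iso_classes"
    using subgroup.mem_carrier[OF subgroup_relator_span assms(2)] by simp
  then show ?thesis
    using subgroup.m_closed[OF subgroup_relator_span assms(1)
        subgroup.m_inv_closed[OF subgroup_relator_span assms(2)]] by simp
qed

lemma relator_span_add:
  assumes "a \<in> relator_span n" "b \<in> relator_span n" shows "a + b \<in> relator_span n"
  using subgroup.m_closed[OF subgroup_relator_span assms] by simp

text \<open>Where the words with one letter more than the rest lie above the rank bound, they vanish by the
  fourth relation, and what remains of the second and third relations are identities between
  words of the next lower rank. These are the extra identities that make words of top rank
  collapse.\<close>

lemma relator_span_R2_top:
  assumes "\<forall>w \<in> {x @ [A, B] @ y @ [B, A] @ z, x @ [A] @ y @ [A] @ z, x @ [B] @ y @ [B] @ z}. gauss_word w"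
    and "gauss_rank (x @ [A, B] @ y @ [B, A] @ z) > n"
  shows "gen (x @ [A] @ y @ [A] @ z) + gen (x @ [B] @ y @ [B] @ z) \<in> relator_span n"
  using relator_span_diff[OF relator_span_base[OF relators.R2[OF assms(1)]] relator_span_base[OF relators.R4[OF _ assms(2)]]]
    assms(1) by (simp add: add.assoc)

lemma relator_span_R3_top:
  assumes "\<forall>w \<in> {x @ [A, B] @ y @ [A, C] @ z @ [B, C] @ t,
             x @ [A, B] @ y @ [A] @ z @ [B] @ t,
             x @ [A] @ y @ [A, C] @ z @ [C] @ t,
             x @ [B] @ y @ [C] @ z @ [B, C] @ t,
             x @ [B, A] @ y @ [C, A] @ z @ [C, B] @ t,
             x @ [B, A] @ y @ [A] @ z @ [B] @ t,
             x @ [A] @ y @ [C, A] @ z @ [C] @ t,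
             x @ [B] @ y @ [C] @ z @ [C, B] @ t}. gauss_word w"
    and "gauss_rank (x @ [A, B] @ y @ [A, C] @ z @ [B, C] @ t) > n"
  shows "(gen (x @ [A, B] @ y @ [A] @ z @ [B] @ t)
      + gen (x @ [A] @ y @ [A, C] @ z @ [C] @ t)
      + gen (x @ [B] @ y @ [C] @ z @ [B, C] @ t))
    - (gen (x @ [B, A] @ y @ [A] @ z @ [B] @ t)
      + gen (x @ [A] @ y @ [C, A] @ z @ [C] @ t)
      + gen (x @ [B] @ y @ [C] @ z @ [C, B] @ t)) \<in> relator_span n"
    (is "?l - ?r \<in> _")
proof -
  let ?p = "gen (x @ [A, B] @ y @ [A, C] @ z @ [B, C] @ t)"
  let ?q = "gen (x @ [B, A] @ y @ [C, A] @ z @ [C, B] @ t)"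
  have "set (x @ [A, B] @ y @ [A, C] @ z @ [B, C] @ t) = set (x @ [B, A] @ y @ [C, A] @ z @ [C, B] @ t)"
    by auto
  then have "?p \<in> relator_span n" "?q \<in> relator_span n"
    using assms by (auto intro!: relator_span_base relators.R4 simp: gauss_rank_def)
  from relator_span_diff[OF relator_span_base[OF relators.R3[OF assms(1)]] relator_span_diff[OF this]]
  show ?thesis by (simp add: algebra_simps)
qed

section \<open>Vanishing of the non-empty words\<close>

text \<open>The crucial calculation. A Gauss word without two equal neighbours and of rank at most 3 is
  \<open>t = ABAB\<close> or one of \<open>a = ABACBC\<close>, \<open>b = ABCABC\<close>, \<open>c = ABCACB\<close>, \<open>d = ABCBAC\<close>,
  \<open>e = ABCBCA\<close>. The second relation applied to \<open>d\<close> gives \<open>d + 2t = 0\<close>, and the third applied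
  to \<open>a\<close> gives \<open>a + t = e\<close>. Relations among words of rank 4 give \<open>2d = 0\<close> and, with a fourth
  letter \<open>D\<close> placed in two of the four gaps of the third relation, \<open>e = 0\<close>, \<open>b = c\<close>, \<open>b = d\<close>
  and \<open>c + a + d = b + 2e\<close>. Hence \<open>a = -t\<close> and \<open>a = -d\<close>, so \<open>d = t\<close>, so both \<open>3t\<close> and \<open>2t\<close>
  vanish, and with \<open>t\<close> everything does.\<close>

lemma short_free_gen_in_relator_span:
  assumes "n \<le> 3"
  shows "{gen [0,1,0,1], gen [0,1,0,2,1,2], gen [0,1,2,0,1,2], gen [0,1,2,0,2,1],
          gen [0,1,2,1,0,2], gen [0,1,2,1,2,0]} \<subseteq> relator_span n"
proof -
  define t where "t = gen [0,1,0,1]"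
  define a where "a = gen [0,1,0,2,1,2]"
  define b where "b = gen [0,1,2,0,1,2]"
  define c where "c = gen [0,1,2,0,2,1]"
  define d where "d = gen [0,1,2,1,0,2]"
  define e where "e = gen [0,1,2,1,2,0]"
  let ?N = "relator_span n"
  have gw: "gauss_word [0,1,0,1]" "gauss_word [0,1,0,2,1,2]" "gauss_word [0,1,2,0,1,2]"
    "gauss_word [0,1,2,0,2,1]" "gauss_word [0,1,2,1,0,2]" "gauss_word [0,1,2,1,2,0]"
    by (simp_all add: gauss_word_def)
  have t: "gen [A,B,A,B] = t" if "A \<noteq> B" for A B
    using gen_pattern[of "[A,B]", OF _ gw(1)] that by (simp add: t_def)
  have a: "gen [A,B,A,C,B,C] = a" if "distinct [A,B,C]" for A B C
    using gen_pattern[OF that gw(2)] by (simp add: a_def)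
  have b: "gen [A,B,C,A,B,C] = b" if "distinct [A,B,C]" for A B C
    using gen_pattern[OF that gw(3)] by (simp add: b_def)
  have c: "gen [A,B,C,A,C,B] = c" if "distinct [A,B,C]" for A B C
    using gen_pattern[OF that gw(4)] by (simp add: c_def)
  have d: "gen [A,B,C,B,A,C] = d" if "distinct [A,B,C]" for A B C
    using gen_pattern[OF that gw(5)] by (simp add: d_def)
  have e: "gen [A,B,C,B,C,A] = e" if "distinct [A,B,C]" for A B C
    using gen_pattern[OF that gw(6)] by (simp add: e_def)
  note canon = t a b c d e
  have short: "gen (x @ [A,A] @ y) \<in> ?N" if "gauss_word (x @ [A,A] @ y)" for x A y
    by (rule relator_span_base[OF relators.R1[OF that]])
  note R2 = relator_span_base[OF relators.R2[where n = n]]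
  note R3 = relator_span_base[OF relators.R3[where n = n]]
  note R2' = relator_span_R2_top[where n = n]
  note R3' = relator_span_R3_top[where n = n]
  note gsimps = gauss_word_def gauss_rank_def canon card_insert_if
  \<comment> \<open>The letters \<open>A, B, C\<close> are 0, 1, 2, and 3 is the additional letter of a word of rank 4.\<close>
  have r2: "d + t + t \<in> ?N"
    using R2[of "[]" 0 1 "[2]" "[2]"] by (simp add: gsimps)
  \<comment> \<open>Both words of rank 3 in this instance are isomorphic to \<open>d\<close>.\<close>
  have r2': "d + d \<in> ?N"
    using R2'[of "[]" 0 3 "[1,2,1]" "[2]"] assms by (simp add: gsimps)
  have r3: "a + t - e \<in> ?N"
  proof -
    have R: "a + t + gen [0, 0, 2, 2] + t - (e + gen [1, 0, 0, 1] + t + gen [1, 2, 2, 1]) \<in> ?N"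
      using R3[of "[]" 0 1 "[]" 2 "[]" "[]"] by (simp add: gsimps)
    have S: "gen [0, 0, 2, 2] \<in> ?N" "gen [1, 0, 0, 1] \<in> ?N" "gen [1, 2, 2, 1] \<in> ?N"
      using short[of "[]" 0 "[2, 2]"]
        short[of "[1]" 0 "[1]"]
        short[of "[1]" 2 "[1]"]
      by (simp_all add: gauss_word_def)
    show ?thesis
      using relator_span_add[OF relator_span_add[OF relator_span_diff[OF R S(1)] S(2)] S(3)] by (simp add: algebra_simps)
  qed
  \<comment> \<open>The labels of the next four facts name the two gaps, among \<open>x, y, z, t\<close>, that contain the letter 3.\<close>
  have xt: "e \<in> ?N"
  proof -
    have R: "e + gen [3, 0, 0, 2, 2, 3] + e - (gen [3, 1, 0, 0, 1, 3] + e + gen [3, 1, 2, 2, 1, 3]) \<in> ?N"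
      using R3'[of "[3]" 0 1 "[]" 2 "[]" "[3]"] assms by (simp add: gsimps)
    have S: "gen [3, 0, 0, 2, 2, 3] \<in> ?N" "gen [3, 1, 0, 0, 1, 3] \<in> ?N" "gen [3, 1, 2, 2, 1, 3] \<in> ?N"
      using short[of "[3]" 0 "[2, 2, 3]"]
        short[of "[3, 1]" 0 "[1, 3]"]
        short[of "[3, 1]" 2 "[1, 3]"]
      by (simp_all add: gauss_word_def)
    show ?thesis
      using relator_span_add[OF relator_span_add[OF relator_span_diff[OF R S(1)] S(2)] S(3)] by (simp add: algebra_simps)
  qed
  have xy: "b - c \<in> ?N"
  proof -
    have R: "b + gen [3, 0, 3, 0, 2, 2] + a - (c + a + gen [3, 1, 3, 2, 2, 1]) \<in> ?N"
      using R3'[of "[3]" 0 1 "[3]" 2 "[]" "[]"] assms by (simp add: gsimps)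
    have S: "gen [3, 0, 3, 0, 2, 2] \<in> ?N" "gen [3, 1, 3, 2, 2, 1] \<in> ?N"
      using short[of "[3, 0, 3, 0]" 2 "[]"]
        short[of "[3, 1, 3]" 2 "[1]"]
      by (simp_all add: gauss_word_def)
    show ?thesis
      using relator_span_add[OF relator_span_diff[OF R S(1)] S(2)] by (simp add: algebra_simps)
  qed
  have yt: "b - d \<in> ?N"
  proof -
    have R: "b + gen [0, 3, 0, 2, 2, 3] + c - (d + c + gen [1, 3, 2, 2, 1, 3]) \<in> ?N"
      using R3'[of "[]" 0 1 "[3]" 2 "[]" "[3]"] assms by (simp add: gsimps)
    have S: "gen [0, 3, 0, 2, 2, 3] \<in> ?N" "gen [1, 3, 2, 2, 1, 3] \<in> ?N"
      using short[of "[0, 3, 0]" 2 "[3]"]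
        short[of "[1, 3]" 2 "[1, 3]"]
      by (simp_all add: gauss_word_def)
    show ?thesis
      using relator_span_add[OF relator_span_diff[OF R S(1)] S(2)] by (simp add: algebra_simps)
  qed
  have yz: "c + a + d - (b + e + e) \<in> ?N"
  proof -
    have "c + a + d - (e + b + e) \<in> ?N"
      using R3'[of "[]" 0 1 "[3]" 2 "[3]" "[]"] assms by (simp add: gsimps)
    then show ?thesis by (simp add: algebra_simps)
  qed
  \<comment> \<open>Eliminate \<open>b - c\<close> and \<open>e\<close> to get \<open>a + d = 0\<close>, and subtract \<open>a + t = e = 0\<close>.\<close>
  have dt: "d - t \<in> ?N"
    using relator_span_diff[OF relator_span_diff[OF relator_span_add[OF relator_span_add[OF
      relator_span_add[OF yz xy] xt] xt] r3] xt] by (simp add: algebra_simps)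
  \<comment> \<open>\<open>(d + 2t) + (d - t) - 2d = t\<close>\<close>
  have t0: "t \<in> ?N"
    using relator_span_diff[OF relator_span_add[OF r2 dt] r2'] by (simp add: algebra_simps)
  have d0: "d \<in> ?N" using relator_span_add[OF dt t0] by simp
  have b0: "b \<in> ?N" using relator_span_add[OF yt d0] by simp
  have c0: "c \<in> ?N" using relator_span_diff[OF b0 xy] by simp
  have a0: "a \<in> ?N" using relator_span_diff[OF relator_span_add[OF r3 xt] t0] by simp
  show ?thesis
    using a0 b0 c0 d0 xt t0 by (simp add: a_def b_def c_def d_def e_def t_def)
qed

text \<open>The six patterns are the linear chord diagrams with one to three chords in which no chord joins
  neighbouring points. The proof follows the first letter \<open>p\<close> to its second occurrence: the
  remaining letters then have at most two ways to pair up.\<close>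

lemma gauss_word_rank_le_3_cases:
  assumes "gauss_word w" "w \<noteq> []" "gauss_rank w \<le> 3"
  obtains (short) x A y where "w = x @ [A, A] @ y"
  | (pattern) L p where "distinct L" "set p \<subseteq> {..<length L}" "w = map ((!) L) p"
     "p \<in> {[0,1,0,1], [0,1,0,2,1,2], [0,1,2,0,1,2], [0,1,2,0,2,1], [0,1,2,1,0,2], [0,1,2,1,2,0]}"
proof (cases "\<exists>x A y. w = x @ [A, A] @ y")
  case True
  then show ?thesis using short by blast
next
  case False
  have adj: "w ! i \<noteq> w ! Suc i" if "Suc i < length w" for i
  proof
    assume "w ! i = w ! Suc i"
    then have "w = take i w @ [w ! i, w ! i] @ drop (Suc (Suc i)) w"
      using that by (metis Cons_nth_drop_Suc Suc_lessD append_Cons append_Nil append_take_drop_id)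
    then show False using False by blast
  qed
  have "length w = (\<Sum>a\<in>set w. count_list w a)"
    by (simp add: sum_count_set)
  also have "\<dots> = 2 * gauss_rank w"
    using assms(1) by (simp add: gauss_word_def gauss_rank_def)
  finally have len: "length w = 2 * gauss_rank w" .
  have "gauss_rank w \<noteq> 0"
    using len assms(2) by (metis length_0_conv mult_0_right)
  then have "gauss_rank w = 1 \<or> gauss_rank w = 2 \<or> gauss_rank w = 3"
    using assms(3) by linarith
  then consider "length w = 2" | "length w = 4" | "length w = 6"
    using len by auto
  then show ?thesis
  proof cases
    case 1
    then obtain p q where w: "w = [p, q]"
      by (auto simp: numeral_eq_Suc length_Suc_conv)
    then show ?thesis
      using assms(1) adj[of 0] by (auto simp: gauss_word_def)
  next
    case 2
    then obtain p q r s where w: "w = [p, q, r, s]"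
      by (auto simp: numeral_eq_Suc length_Suc_conv)
    then have ne: "p \<noteq> q" "q \<noteq> r" "r \<noteq> s"
      using adj[of 0] adj[of 1] adj[of 2] by auto
    then have "r = p" "s = q"
      using assms(1) by (auto simp: w gauss_word_def split: if_splits)
    then show ?thesis
      using pattern[of "[p, q]" "[0,1,0,1]"] ne w by simp
  next
    case 3
    then obtain p q r s t u where w: "w = [p, q, r, s, t, u]"
      by (auto simp: numeral_eq_Suc length_Suc_conv)
    then have ne: "p \<noteq> q" "q \<noteq> r" "r \<noteq> s" "s \<noteq> t" "t \<noteq> u"
      using adj[of 0] adj[of 1] adj[of 2] adj[of 3] adj[of 4] by auto
    have count: "count_list [p, q, r, s, t, u] x = 2" if "x \<in> {p, q, r, s, t}" for x
      using that by (intro bspec[OF assms(1)[unfolded gauss_word_def w]]) auto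
    consider "r = p" "s \<noteq> p" "t \<noteq> p" "u \<noteq> p" | "s = p" "r \<noteq> p" "t \<noteq> p" "u \<noteq> p"
      | "t = p" "r \<noteq> p" "s \<noteq> p" "u \<noteq> p" | "u = p" "r \<noteq> p" "s \<noteq> p" "t \<noteq> p"
      using count[of p] ne(1) by (simp split: if_split_asm)
    then show ?thesis
    proof cases
      case 1
      then have "t = q \<and> u = s \<and> s \<noteq> q"
        using count[of q] count[of s] count[of t] ne by (simp split: if_split_asm)
      then show ?thesis
        using pattern[of "[p, q, s]" "[0,1,0,2,1,2]"] 1 ne w by simp
    next
      case 2
      then have "t = q \<and> u = r \<or> t = r \<and> u = q"
        using count[of q] count[of r] ne by (simp split: if_split_asm)
      then show ?thesis
        using pattern[of "[p, q, r]" "[0,1,2,0,1,2]"] pattern[of "[p, q, r]" "[0,1,2,0,2,1]"] 2 ne w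
        by fastforce
    next
      case 3
      then have "s = q \<and> u = r"
        using count[of q] count[of r] ne by (simp split: if_split_asm)
      then show ?thesis
        using pattern[of "[p, q, r]" "[0,1,2,1,0,2]"] 3 ne w by simp
    next
      case 4
      then have "s = q \<and> t = r"
        using count[of q] count[of r] ne by (simp split: if_split_asm)
      then show ?thesis
        using pattern[of "[p, q, r]" "[0,1,2,1,2,0]"] 4 ne w by simp
    qed
  qed
qed

lemma gen_in_relator_span:
  assumes "gauss_word w" "w \<noteq> []" "n \<le> 3"
  shows "gen w \<in> relator_span n"
proof (cases "gauss_rank w \<le> 3")
  case False
  then show ?thesis
    using assms by (intro relator_span_base relators.R4) auto
next
  case True
  with assms(1,2) show ?thesis
  proof (cases rule: gauss_word_rank_le_3_cases)
    case (short x A y)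
    then show ?thesis
      using relator_span_base[OF relators.R1] assms(1) by blast
  next
    case (pattern L p)
    have "gauss_word p"
      using pattern(4) by (auto simp: gauss_word_def)
    then have "gen w = gen p"
      using gen_pattern pattern(1-3) by blast
    moreover have "gen p \<in> relator_span n"
      using short_free_gen_in_relator_span[OF assms(3)] pattern(4) by auto
    ultimately show ?thesis by simp
  qed
qed

section \<open>The groups for rank at most 3\<close>

lemma iso_class_empty: "iso_rel `` {w} = iso_rel `` {[]} \<longleftrightarrow> w = []" if "gauss_word w"
proof
  assume "iso_rel `` {w} = iso_rel `` {[]}"
  then have "(w, []) \<in> iso_rel"
    using equiv_class_self[OF equiv_iso_rel, of "[]"] by (auto simp: gauss_word_def)
  then show "w = []" by (auto simp: iso_rel_def word_iso_def)
qed simp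

text \<open>No relation involves the empty word, so reading off its coefficient is well defined on the
  quotient. It induces the isomorphism to the integers.\<close>

definition empty_coeff :: "(word set \<Rightarrow>\<^sub>0 int) \<Rightarrow> int" where
  "empty_coeff c = Poly_Mapping.lookup c (iso_rel `` {[]})"

lemma empty_coeff_gen: "gauss_word w \<Longrightarrow> empty_coeff (gen w) = (if w = [] then 1 else 0)"
  using iso_class_empty by (auto simp: empty_coeff_def gen_def)

lemma empty_coeff_hom: "group_hom (free_Abelian_group iso_classes) integer_group empty_coeff"
  by (rule group_hom.intro) (auto simp: group_hom_axioms_def hom_def empty_coeff_def lookup_add)

lemma empty_coeff_relators: "r \<in> relators n \<Longrightarrow> empty_coeff r = 0"
proof -
  have add: "empty_coeff (a + b) = empty_coeff a + empty_coeff b"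
    and diff: "empty_coeff (a - b) = empty_coeff a - empty_coeff b" for a b
    by (simp_all add: empty_coeff_def lookup_add lookup_minus)
  show "r \<in> relators n \<Longrightarrow> empty_coeff r = 0"
  proof (induction rule: relators.induct)
    case (R4 w)
    then show ?case by (auto simp: empty_coeff_gen gauss_rank_def)
  qed (simp_all add: add diff empty_coeff_gen)
qed

text \<open>A combination without the empty word is a combination of non-empty words, and by the
  vanishing result each of these lies in the subgroup of relations; so nothing else is in the kernel.\<close>

lemma kernel_empty_coeff:
  assumes "n \<le> 3"
  shows "kernel (free_Abelian_group iso_classes) integer_group empty_coeff = relator_span n"
proof
  interpret group_hom "free_Abelian_group iso_classes" integer_group empty_coeff
    by (rule empty_coeff_hom)
  have "relators n \<subseteq> kernel (free_Abelian_group iso_classes) integer_group empty_coeff"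
    using relators_in_carrier[of n] empty_coeff_relators
    by (auto simp: kernel_def simp del: carrier_free_Abelian_group_iff)
  then show "relator_span n \<subseteq> kernel (free_Abelian_group iso_classes) integer_group empty_coeff"
    unfolding relator_span_def by (intro G.generate_subgroup_incl subgroup_kernel)
  show "kernel (free_Abelian_group iso_classes) integer_group empty_coeff \<subseteq> relator_span n"
  proof
    fix c assume "c \<in> kernel (free_Abelian_group iso_classes) integer_group empty_coeff"
    then have c: "Poly_Mapping.keys c \<subseteq> iso_classes" "iso_rel `` {[]} \<notin> Poly_Mapping.keys c"
      by (auto simp: kernel_def empty_coeff_def in_keys_iff)
    then have "Poly_Mapping.keys c \<subseteq> iso_classes - {iso_rel `` {[]}}" by blast
    then show "c \<in> relator_span n"
    proof (induction c rule: frag_induction)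
      case (one k)
      then obtain w where "gauss_word w" "k = iso_rel `` {w}" "w \<noteq> []"
        by (auto simp: iso_classes_def elim: quotientE)
      then show ?case
        using gen_in_relator_span[OF _ _ assms] by (simp add: gen_def)
    qed (auto intro: relator_span_zero relator_span_diff)
  qed
qed

lemma gauss_group_iso_integer_group:
  assumes "n \<le> 3" shows "gauss_group n \<cong> integer_group"
proof -
  interpret group_hom "free_Abelian_group iso_classes" integer_group empty_coeff
    by (rule empty_coeff_hom)
  have "z \<in> empty_coeff ` carrier (free_Abelian_group iso_classes)" for z
  proof
    show "z = empty_coeff (frag_cmul z (gen []))"
      using empty_coeff_gen[of "[]"] by (simp add: empty_coeff_def gauss_word_def)
    show "frag_cmul z (gen []) \<in> carrier (free_Abelian_group iso_classes)"
      using gen_in_carrier[of "[]"] keys_cmul[of z "gen []"] by (auto simp: gauss_word_def)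
  qed
  then have "empty_coeff ` carrier (free_Abelian_group iso_classes) = carrier integer_group"
    by auto
  from FactGroup_iso[OF this] show ?thesis
    unfolding gauss_group_def kernel_empty_coeff[OF assms] relator_span_def .
qed

section \<open>Homotopy classes of words with semi-letters\<close>

lemma equiv_homotopy_rel: "equiv {w. gauss_word w} homotopy_rel"
  by (rule equivI)
    (auto simp: homotopy_rel_def refl_on_def sym_def trans_def intro: equivclp_sym equivclp_trans)

lemma homotopy_class_step:
  assumes "homotopy_step u v" shows "homotopy_class u = homotopy_class v"
proof -
  have "gauss_word u \<and> gauss_word v"
    using assms by cases auto
  then have "(u, v) \<in> homotopy_rel"
    using assms by (auto simp: homotopy_rel_def)
  then show ?thesis
    unfolding homotopy_class_def by (rule equiv_class_eq[OF equiv_homotopy_rel])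
qed

lemma keys_semi_word: "gauss_word w \<Longrightarrow> Poly_Mapping.keys (semi_word As w) \<subseteq> homotopy_classes"
proof (induction As arbitrary: w)
  case Nil
  then show ?case by (auto simp: homotopy_classes_def homotopy_class_def quotient_def)
next
  case (Cons A As)
  then show ?case
    using keys_diff[of "semi_word As w" "semi_word As (removeAll A w)"] gauss_word_removeAll by fastforce
qed

lemma semi_word_move: "semi_word (As @ A # Bs) w = semi_word (A # As @ Bs) w"
proof (induction As arbitrary: w)
  case (Cons C As)
  have "removeAll A (removeAll C w) = removeAll C (removeAll A w)"
    by (simp add: removeAll_filter_not_eq filter_filter conj_commute)
  then show ?case by (simp add: Cons)
qed simp

lemma semi_word_perm: "mset As = mset Bs \<Longrightarrow> semi_word As w = semi_word Bs w"
proof (induction As arbitrary: Bs w)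
  case (Cons A As)
  then have "A \<in> set Bs"
    by (metis list.set_intros(1) mset_eq_setD)
  then obtain Xs Ys where Bs: "Bs = Xs @ A # Ys"
    by (meson split_list)
  then have "mset As = mset (Xs @ Ys)"
    using Cons.prems by simp
  from Cons.IH[OF this] show ?case
    by (simp add: Bs semi_word_move)
qed simp

text \<open>Resolving a semi-letter deletes it from the word. A move that does not involve the semi-letters
  survives these deletions, so words with semi-letters may be changed by such moves. The relation
  \<open>P\<close> is to be read as the pair of shapes that the move connects.\<close>

lemma semi_word_cong:
  assumes "P u v"
    and "\<And>u v D. D \<in> set As \<Longrightarrow> P u v \<Longrightarrow> P (removeAll D u) (removeAll D v)"
    and "\<And>u v. P u v \<Longrightarrow> homotopy_class u = homotopy_class v"
  shows "semi_word As u = semi_word As v"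
  using assms(1,2)
proof (induction As arbitrary: u v)
  case (Cons A As)
  have "semi_word As u = semi_word As v"
    by (rule Cons.IH[OF Cons.prems(1)]) (simp add: Cons.prems(2))
  moreover have "semi_word As (removeAll A u) = semi_word As (removeAll A v)"
    by (rule Cons.IH) (simp_all add: Cons.prems)
  ultimately show ?case by simp
qed (simp add: assms(3))

lemma semi_word_map:
  assumes "gauss_word w" "inj_on f (set w \<union> set As)"
  shows "semi_word (map f As) (map f w) = semi_word As w"
  using assms
proof (induction As arbitrary: w)
  case Nil
  then have "homotopy_step w (map f w)"
    by (intro homotopy_step.iso word_iso_map gauss_word_map) auto
  then show ?case by (simp add: homotopy_class_step)
next
  case (Cons A As)
  have "removeAll (f A) (map f w) = map f (removeAll A w)"
    using Cons.prems(2) by (auto simp: removeAll_filter_not_eq filter_map inj_on_def intro!: arg_cong[where f = "map f"] filter_cong)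
  moreover have "inj_on f (set w \<union> set As)" "inj_on f (set (removeAll A w) \<union> set As)"
    using Cons.prems(2) by (auto intro: inj_on_subset)
  ultimately show ?case
    using Cons gauss_word_removeAll by simp
qed

section \<open>The fully resolved combination of a word\<close>

text \<open>All letters are made semi-letters. By inclusion and exclusion a word is the sum of the symbols of
  its subwords, which is why the homotopy moves for words become the relations of the groups
  \<open>G\<^sub>n\<close> for symbols.\<close>

definition symbol :: "word \<Rightarrow> (word set \<Rightarrow>\<^sub>0 int)" where
  "symbol w = semi_word (remdups w) w"

lemma symbol_eq:
  assumes "distinct As" "set As = set w" shows "symbol w = semi_word As w"
proof -
  have "mset (remdups w) = mset As"
    using assms by (simp add: set_eq_iff_mset_eq_distinct[symmetric])
  then show ?thesis
    unfolding symbol_def by (rule semi_word_perm)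
qed

lemma symbol_iso:
  assumes "gauss_word w" "inj_on f (set w)" shows "symbol (map f w) = symbol w"
proof -
  have "symbol (map f w) = semi_word (map f (remdups w)) (map f w)"
    using assms by (intro symbol_eq) (auto simp: distinct_map)
  then show ?thesis
    using semi_word_map[OF assms(1), of f "remdups w"] assms(2) by (simp add: symbol_def)
qed

text \<open>Resolving only \<open>A\<close> yields the two sides of the first homotopy move, with the other letters as
  semi-letters.\<close>

lemma symbol_R1:
  assumes "gauss_word (x @ [A, A] @ y)" shows "symbol (x @ [A, A] @ y) = 0"
proof -
  have A: "A \<notin> set (x @ y)"
    using assms by (auto simp: gauss_word_def count_list_0_iff)
  let ?R = "remdups (x @ y)"
  let ?P = "\<lambda>u v. \<exists>x y. A \<notin> set (x @ y) \<and> u = x @ [A, A] @ y \<and> v = x @ y \<and> gauss_word u"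
  have "symbol (x @ [A, A] @ y) = semi_word (A # ?R) (x @ [A, A] @ y)"
    using A by (intro symbol_eq) auto
  also have "\<dots> = semi_word ?R (x @ [A, A] @ y) - semi_word ?R (x @ y)"
    using A by simp
  also have "semi_word ?R (x @ [A, A] @ y) = semi_word ?R (x @ y)"
  proof (rule semi_word_cong[where P = ?P])
    show "?P (x @ [A, A] @ y) (x @ y)"
      using A assms by blast
  next
    fix u v D assume "D \<in> set ?R" "?P u v"
    then obtain x' y' where "D \<noteq> A" "A \<notin> set (x' @ y')" "u = x' @ [A, A] @ y'" "v = x' @ y'" "gauss_word u"
      using A by auto
    then show "?P (removeAll D u) (removeAll D v)"
      using gauss_word_removeAll[of u D]
      by (intro exI[of _ "removeAll D x'"] exI[of _ "removeAll D y'"]) auto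
  next
    fix u v assume "?P u v"
    then obtain x' y' where u: "A \<notin> set (x' @ y')" "u = x' @ [A, A] @ y'" "v = x' @ y'" "gauss_word u"
      by blast
    then have "gauss_word v"
      using gauss_word_removeAll[of u A] by simp
    then show "homotopy_class u = homotopy_class v"
      using u homotopy_step.H1 by (auto intro!: homotopy_class_step)
  qed
  finally show ?thesis by simp
qed

text \<open>Write \<open>[X]\<close> for the word in which, of \<open>A\<close> and \<open>B\<close>, exactly the letters in \<open>X\<close> are kept and all
  other letters are semi-letters. The sum is
  \<open>([AB] - [A] - [B] + []) + ([A] - []) + ([B] - []) = [AB] - []\<close>,
  the difference of the two sides of the second homotopy move.\<close>

lemma symbol_R2:
  assumes "gauss_word (x @ [A, B] @ y @ [B, A] @ z)"
  shows "symbol (x @ [A, B] @ y @ [B, A] @ z) + symbol (x @ [A] @ y @ [A] @ z)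
    + symbol (x @ [B] @ y @ [B] @ z) = 0"
proof -
  have AB: "A \<noteq> B" "A \<notin> set (x @ y @ z)" "B \<notin> set (x @ y @ z)"
    using assms by (auto simp: gauss_word_def count_list_0_iff split: if_splits)
  let ?R = "remdups (x @ y @ z)"
  let ?P = "\<lambda>u v. \<exists>x y z. A \<notin> set (x @ y @ z) \<and> B \<notin> set (x @ y @ z)
    \<and> u = x @ [A, B] @ y @ [B, A] @ z \<and> v = x @ y @ z \<and> gauss_word u"
  have full: "symbol (x @ [A, B] @ y @ [B, A] @ z) = semi_word (A # B # ?R) (x @ [A, B] @ y @ [B, A] @ z)"
    using AB by (intro symbol_eq) auto
  have only_A: "symbol (x @ [A] @ y @ [A] @ z) = semi_word (A # ?R) (x @ [A] @ y @ [A] @ z)"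
    using AB by (intro symbol_eq) auto
  have only_B: "symbol (x @ [B] @ y @ [B] @ z) = semi_word (B # ?R) (x @ [B] @ y @ [B] @ z)"
    using AB by (intro symbol_eq) auto
  have move: "semi_word ?R (x @ [A, B] @ y @ [B, A] @ z) = semi_word ?R (x @ y @ z)"
  proof (rule semi_word_cong[where P = ?P])
    show "?P (x @ [A, B] @ y @ [B, A] @ z) (x @ y @ z)"
      using AB assms by blast
  next
    fix u v D assume "D \<in> set ?R" "?P u v"
    then obtain x' y' z' where "D \<noteq> A" "D \<noteq> B" "A \<notin> set (x' @ y' @ z')" "B \<notin> set (x' @ y' @ z')"
        "u = x' @ [A, B] @ y' @ [B, A] @ z'" "v = x' @ y' @ z'" "gauss_word u"
      using AB by auto
    then show "?P (removeAll D u) (removeAll D v)"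
      using gauss_word_removeAll[of u D]
      by (intro exI[of _ "removeAll D x'"] exI[of _ "removeAll D y'"] exI[of _ "removeAll D z'"]) auto
  next
    fix u v assume "?P u v"
    then obtain x' y' z' where u: "A \<notin> set (x' @ y' @ z')" "B \<notin> set (x' @ y' @ z')"
        "u = x' @ [A, B] @ y' @ [B, A] @ z'" "v = x' @ y' @ z'" "gauss_word u"
      by blast
    then have "gauss_word v"
      using AB(1) gauss_word_removeAll[OF gauss_word_removeAll[of u A], of B] by simp
    then show "homotopy_class u = homotopy_class v"
      using u homotopy_step.H2 by (auto intro!: homotopy_class_step)
  qed
  show ?thesis
    using move unfolding full only_A only_B by (simp add: AB[simplified] AB(1)[THEN not_sym] algebra_simps)
qed

text \<open>In the same notation each side equals \<open>[ABC] - [A] - [B] - [C] + 2 []\<close>. Words keeping at most one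
  of the three letters are the same on both sides, and \<open>[ABC]\<close> agrees by the third homotopy
  move.\<close>

lemma symbol_R3:
  assumes "gauss_word (x @ [A, B] @ y @ [A, C] @ z @ [B, C] @ t)"
  shows "symbol (x @ [A, B] @ y @ [A, C] @ z @ [B, C] @ t)
      + symbol (x @ [A, B] @ y @ [A] @ z @ [B] @ t)
      + symbol (x @ [A] @ y @ [A, C] @ z @ [C] @ t)
      + symbol (x @ [B] @ y @ [C] @ z @ [B, C] @ t)
    = symbol (x @ [B, A] @ y @ [C, A] @ z @ [C, B] @ t)
      + symbol (x @ [B, A] @ y @ [A] @ z @ [B] @ t)
      + symbol (x @ [A] @ y @ [C, A] @ z @ [C] @ t)
      + symbol (x @ [B] @ y @ [C] @ z @ [C, B] @ t)"
proof -
  have ABC: "A \<noteq> B" "A \<noteq> C" "B \<noteq> C" "A \<notin> set (x @ y @ z @ t)" "B \<notin> set (x @ y @ z @ t)"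
      "C \<notin> set (x @ y @ z @ t)"
    using assms by (auto simp: gauss_word_def count_list_0_iff split: if_splits)
  let ?R = "remdups (x @ y @ z @ t)"
  let ?l = "\<lambda>x y z t. x @ [A, B] @ y @ [A, C] @ z @ [B, C] @ t"
  let ?r = "\<lambda>x y z t. x @ [B, A] @ y @ [C, A] @ z @ [C, B] @ t"
  let ?P = "\<lambda>u v. \<exists>x y z t. u = ?l x y z t \<and> v = ?r x y z t \<and> gauss_word u"
  have full: "symbol w = semi_word (A # B # C # ?R) w" if "set w = {A, B, C} \<union> set (x @ y @ z @ t)" for w
    using ABC that by (intro symbol_eq) auto
  have two: "symbol w = semi_word (D # E # ?R) w"
    if "set w = {D, E} \<union> set (x @ y @ z @ t)" "D \<noteq> E" "{D, E} \<subseteq> {A, B, C}" for w D E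
    using ABC that by (intro symbol_eq) auto
  have three_letters: "symbol (?l x y z t) = semi_word (A # B # C # ?R) (?l x y z t)"
    "symbol (?r x y z t) = semi_word (A # B # C # ?R) (?r x y z t)"
    by (intro full; auto)+
  have two_letters: "symbol (x @ [A, B] @ y @ [A] @ z @ [B] @ t) = semi_word (A # B # ?R) (x @ [A, B] @ y @ [A] @ z @ [B] @ t)"
    "symbol (x @ [A] @ y @ [A, C] @ z @ [C] @ t) = semi_word (A # C # ?R) (x @ [A] @ y @ [A, C] @ z @ [C] @ t)"
    "symbol (x @ [B] @ y @ [C] @ z @ [B, C] @ t) = semi_word (B # C # ?R) (x @ [B] @ y @ [C] @ z @ [B, C] @ t)"
    "symbol (x @ [B, A] @ y @ [A] @ z @ [B] @ t) = semi_word (A # B # ?R) (x @ [B, A] @ y @ [A] @ z @ [B] @ t)"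
    "symbol (x @ [A] @ y @ [C, A] @ z @ [C] @ t) = semi_word (A # C # ?R) (x @ [A] @ y @ [C, A] @ z @ [C] @ t)"
    "symbol (x @ [B] @ y @ [C] @ z @ [C, B] @ t) = semi_word (B # C # ?R) (x @ [B] @ y @ [C] @ z @ [C, B] @ t)"
    using ABC(1-3) by (intro two; auto)+
  have move: "semi_word ?R (?l x y z t) = semi_word ?R (?r x y z t)"
  proof (rule semi_word_cong[where P = ?P])
    show "?P (?l x y z t) (?r x y z t)"
      using assms by blast
  next
    fix u v D assume "D \<in> set ?R" "?P u v"
    then obtain x' y' z' t' where "D \<noteq> A" "D \<noteq> B" "D \<noteq> C"
        "u = ?l x' y' z' t'" "v = ?r x' y' z' t'" "gauss_word u"
      using ABC by auto
    then show "?P (removeAll D u) (removeAll D v)"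
      using gauss_word_removeAll[of u D]
      by (intro exI[of _ "removeAll D x'"] exI[of _ "removeAll D y'"] exI[of _ "removeAll D z'"]
          exI[of _ "removeAll D t'"]) auto
  next
    fix u v assume "?P u v"
    then obtain x' y' z' t' where u: "u = ?l x' y' z' t'" "v = ?r x' y' z' t'" "gauss_word u"
      by blast
    then have "gauss_word v"
      using gauss_word_cong_mset[of u v] by simp
    then show "homotopy_class u = homotopy_class v"
      using u homotopy_step.H3 by (auto intro!: homotopy_class_step)
  qed
  show ?thesis
    using move unfolding three_letters two_letters by (simp add: ABC[simplified] ABC(1-3)[THEN not_sym] algebra_simps)
qed

section \<open>Finite type invariants of low degree\<close>

lemma linear_extension_eq:
  assumes "comm_group A" "v \<in> homotopy_classes \<rightarrow> carrier A" "Poly_Mapping.keys c \<subseteq> S" "finite S"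
    "S \<subseteq> homotopy_classes"
  shows "linear_extension A v c = finprod A (\<lambda>k. v k [^]\<^bsub>A\<^esub> Poly_Mapping.lookup c k) S"
proof -
  interpret comm_group A by fact
  show ?thesis
    unfolding linear_extension_def
  proof (rule finprod_mono_neutral_cong_left)
    show "v k [^]\<^bsub>A\<^esub> Poly_Mapping.lookup c k = \<one>\<^bsub>A\<^esub>" if "k \<in> S - Poly_Mapping.keys c" for k
      using that by (simp add: in_keys_iff)
    show "(\<lambda>k. v k [^]\<^bsub>A\<^esub> Poly_Mapping.lookup c k) \<in> S \<rightarrow> carrier A"
      using assms(2,5) by blast
  qed (use assms in auto)
qed

lemma linear_extension_hom:
  assumes "comm_group A" "v \<in> homotopy_classes \<rightarrow> carrier A"
  shows "group_hom (free_Abelian_group homotopy_classes) A (linear_extension A v)"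
proof -
  interpret comm_group A by fact
  have "linear_extension A v \<in> hom (free_Abelian_group homotopy_classes) A"
  proof (rule homI)
    fix c assume "c \<in> carrier (free_Abelian_group homotopy_classes)"
    then show "linear_extension A v c \<in> carrier A"
      using assms(2) unfolding linear_extension_def by (intro finprod_closed) auto
  next
    fix c d assume "c \<in> carrier (free_Abelian_group homotopy_classes)"
      "d \<in> carrier (free_Abelian_group homotopy_classes)"
    then have keys: "Poly_Mapping.keys c \<subseteq> homotopy_classes" "Poly_Mapping.keys d \<subseteq> homotopy_classes"
      by simp_all
    let ?S = "Poly_Mapping.keys c \<union> Poly_Mapping.keys d"
    have S: "finite ?S" "?S \<subseteq> homotopy_classes"
      using keys by auto
    then have v: "v k \<in> carrier A" if "k \<in> ?S" for k
      using assms(2) that by blast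
    have "linear_extension A v (c + d)
        = finprod A (\<lambda>k. v k [^]\<^bsub>A\<^esub> (Poly_Mapping.lookup c k + Poly_Mapping.lookup d k)) ?S"
      using linear_extension_eq[OF assms keys_add S] by (simp add: lookup_add)
    also have "\<dots> = finprod A (\<lambda>k. v k [^]\<^bsub>A\<^esub> Poly_Mapping.lookup c k
        \<otimes>\<^bsub>A\<^esub> v k [^]\<^bsub>A\<^esub> Poly_Mapping.lookup d k) ?S"
      by (rule finprod_cong') (auto simp: int_pow_mult v)
    also have "\<dots> = linear_extension A v c \<otimes>\<^bsub>A\<^esub> linear_extension A v d"
      using linear_extension_eq[OF assms _ S] v by (subst finprod_multf) auto
    finally show "linear_extension A v (c \<otimes>\<^bsub>free_Abelian_group homotopy_classes\<^esub> d)
        = linear_extension A v c \<otimes>\<^bsub>A\<^esub> linear_extension A v d"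
      by simp
  qed
  then show ?thesis
    by (intro group_hom.intro) (auto simp: group_hom_axioms_def is_group)
qed

text \<open>The value on a class is the symbol of a representative; by isomorphism invariance the choice is
  immaterial.\<close>

definition symbol_extension :: "(word set \<Rightarrow>\<^sub>0 int) \<Rightarrow> (word set \<Rightarrow>\<^sub>0 int)" where
  "symbol_extension = frag_extend (\<lambda>k. symbol (SOME w. w \<in> k))"

lemma symbol_extension_gen:
  assumes "gauss_word w" shows "symbol_extension (gen w) = symbol w"
proof -
  define u where "u = (SOME u. u \<in> iso_rel `` {w})"
  have "u \<in> iso_rel `` {w}"
    unfolding u_def some_in_eq using equiv_class_self[OF equiv_iso_rel, of w] assms by blast
  then obtain f where "u = map f w" "inj_on f (set w)"
    unfolding iso_rel_def word_iso_def bij_betw_def by blast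
  then show ?thesis
    using symbol_iso[OF assms]
    unfolding symbol_extension_def gen_def frag_extend_of u_def[symmetric] by simp
qed

lemma symbol_extension_add: "symbol_extension (a + b) = symbol_extension a + symbol_extension b"
  by (simp add: symbol_extension_def frag_extend_add)

lemma symbol_extension_diff: "symbol_extension (a - b) = symbol_extension a - symbol_extension b"
  by (simp add: symbol_extension_def frag_extend_diff)

lemma symbol_extension_relators:
  assumes "r \<in> relators n"
  shows "symbol_extension r = 0 \<or> (\<exists>w. gauss_word w \<and> gauss_rank w > n \<and> symbol_extension r = symbol w)"
  using assms
proof (induction rule: relators.induct)
  case (R1 x A y)
  then show ?case by (simp add: symbol_extension_gen symbol_R1[simplified])
next
  case (R2 x A B y z)
  then show ?case
    using symbol_R2[of x A B y z] by (simp add: symbol_extension_add symbol_extension_gen)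
next
  case (R3 x A B y C z t)
  then show ?case
    using symbol_R3[of x A B y C z t] by (simp add: symbol_extension_add symbol_extension_diff symbol_extension_gen)
next
  case (R4 w)
  then show ?case using symbol_extension_gen by blast
qed

text \<open>Relations of \<open>G\<^sub>n\<close> are sent by the symbol to zero or, for words of rank above \<open>n\<close>, to a word
  with more than \<open>n\<close> semi-letters.
  An invariant that vanishes on the latter is therefore a homomorphism on \<open>G\<^sub>n\<close>, and kills the
  symbol of every word that is zero there.\<close>

lemma symbol_in_kernel:
  assumes "comm_group A" "v \<in> homotopy_classes \<rightarrow> carrier A" "vanishes_above A v n" "gauss_word w"
    and "gen w \<in> relator_span n"
  shows "linear_extension A v (symbol w) = \<one>\<^bsub>A\<^esub>"
proof -
  interpret group_hom "free_Abelian_group homotopy_classes" A "linear_extension A v"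
    using assms(1,2) by (rule linear_extension_hom)
  let ?K = "kernel (free_Abelian_group homotopy_classes) A (linear_extension A v)"
  have keys_symbol: "Poly_Mapping.keys (symbol u) \<subseteq> homotopy_classes" if "gauss_word u" for u
    using that keys_semi_word by (simp add: symbol_def)
  have relator: "symbol_extension r \<in> ?K" if r: "r \<in> relators n" for r
    using symbol_extension_relators[OF r]
  proof
    assume "symbol_extension r = 0"
    then show ?thesis using subgroup.one_closed[OF subgroup_kernel] by simp
  next
    assume "\<exists>u. gauss_word u \<and> gauss_rank u > n \<and> symbol_extension r = symbol u"
    then obtain u where u: "gauss_word u" "gauss_rank u > n" "symbol_extension r = symbol u"
      by blast
    have "length (remdups u) > n"
      using u(2) by (simp add: gauss_rank_def length_remdups_card_conv)
    then have "linear_extension A v (symbol u) = \<one>\<^bsub>A\<^esub>"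
      using assms(3) u(1) unfolding vanishes_above_def symbol_def by auto
    then show ?thesis
      using u keys_symbol by (simp add: kernel_def)
  qed
  have "symbol_extension c \<in> ?K" if "c \<in> relator_span n" for c
    using that unfolding relator_span_def
  proof (induction rule: generate.induct)
    case one
    then show ?case using subgroup.one_closed[OF subgroup_kernel] by (simp add: symbol_extension_def)
  next
    case (incl r)
    then show ?case by (rule relator)
  next
    case (inv r)
    have "Poly_Mapping.keys r \<subseteq> iso_classes"
      using subsetD[OF relators_in_carrier inv] by simp
    moreover have "Poly_Mapping.keys (symbol_extension r) \<subseteq> homotopy_classes"
      using relator[OF inv] by (simp add: kernel_def)
    ultimately show ?case
      using subgroup.m_inv_closed[OF subgroup_kernel relator[OF inv]]
      by (simp add: symbol_extension_def frag_extend_minus)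
  next
    case (eng a b)
    then show ?case
      using subgroup.m_closed[OF subgroup_kernel eng.IH] by (simp add: symbol_extension_add)
  qed
  then have "symbol w \<in> ?K"
    using assms(4,5) symbol_extension_gen by metis
  then show ?thesis by (simp add: kernel_def)
qed

text \<open>If \<open>B\<close> is not a semi-letter, the word is the sum of the word with \<open>B\<close> made a semi-letter and the
  word without \<open>B\<close>. Both have fewer ordinary letters, so by induction the word is a sum of symbols
  of non-empty words.\<close>

lemma vanishes_above_zero:
  assumes "comm_group A" "v \<in> homotopy_classes \<rightarrow> carrier A"
    and symbols: "\<And>w. gauss_word w \<Longrightarrow> w \<noteq> [] \<Longrightarrow> linear_extension A v (symbol w) = \<one>\<^bsub>A\<^esub>"
  shows "vanishes_above A v 0"
proof -
  interpret group_hom "free_Abelian_group homotopy_classes" A "linear_extension A v"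
    using assms(1,2) by (rule linear_extension_hom)
  have "linear_extension A v (semi_word As w) = \<one>\<^bsub>A\<^esub>"
    if "gauss_word w" "distinct As" "set As \<subseteq> set w" "As \<noteq> []" for As w
    using that
  proof (induction "card (set w - set As)" arbitrary: As w rule: less_induct)
    case less
    show ?case
    proof (cases "set As = set w")
      case True
      then have "w \<noteq> []" using less.prems(4) by auto
      then show ?thesis
        using symbols[of w] symbol_eq[OF less.prems(2) True] less.prems(1) by simp
    next
      case False
      then obtain B where B: "B \<in> set w" "B \<notin> set As"
        using less.prems(3) by blast
      let ?d = "semi_word (B # As) w" and ?e = "semi_word As (removeAll B w)"
      have "set w - set (B # As) \<subset> set w - set As" "set (removeAll B w) - set As \<subset> set w - set As"
        using B by auto
      then have smaller: "card (set w - set (B # As)) < card (set w - set As)"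
        "card (set (removeAll B w) - set As) < card (set w - set As)"
        by (simp_all only: psubset_card_mono finite_Diff finite_set)
      have gw: "gauss_word (removeAll B w)"
        using less.prems(1) by (rule gauss_word_removeAll)
      have "linear_extension A v ?d = \<one>\<^bsub>A\<^esub>"
        using B less.prems by (intro less.hyps smaller) auto
      moreover have "linear_extension A v ?e = \<one>\<^bsub>A\<^esub>"
        using B less.prems gw by (intro less.hyps smaller) auto
      moreover have "linear_extension A v (?d + ?e)
          = linear_extension A v ?d \<otimes>\<^bsub>A\<^esub> linear_extension A v ?e"
        using hom_mult[of ?d ?e] keys_semi_word[OF less.prems(1), of "B # As"] keys_semi_word[OF gw, of As]
        by (simp del: semi_word.simps)
      ultimately show ?thesis by simp
    qed
  qed
  then show ?thesis
    unfolding vanishes_above_def by auto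
qed

theorem proposition8p1:
  shows "gauss_group 1 \<cong> integer_group \<and>
         gauss_group 2 \<cong> integer_group \<and>
         gauss_group 3 \<cong> integer_group \<and>
         (\<forall>(A :: ('b, 'm) monoid_scheme) v.
            comm_group A \<and> finite_type_invariant A v \<longrightarrow>
              invariant_degree A v \<notin> {1, 2, 3})"
proof (intro conjI allI impI)
  fix A :: "('b, 'm) monoid_scheme" and v
  assume Av: "comm_group A \<and> finite_type_invariant A v"
  then have v: "comm_group A" "v \<in> homotopy_classes \<rightarrow> carrier A"
    and ex: "\<exists>n. vanishes_above A v n"
    by (auto simp: finite_type_invariant_def homotopy_invariant_def)
  let ?d = "invariant_degree A v"
  have vanish: "vanishes_above A v ?d"
    unfolding invariant_degree_def using ex by (rule LeastI_ex)
  have "?d = 0" if "?d \<le> 3"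
  proof -
    have "vanishes_above A v 0"
      using v
    proof (rule vanishes_above_zero)
      fix w assume "gauss_word w" "w \<noteq> []"
      then show "linear_extension A v (symbol w) = \<one>\<^bsub>A\<^esub>"
        by (intro symbol_in_kernel[OF v vanish] gen_in_relator_span that)
    qed
    then show ?thesis
      by (simp add: invariant_degree_def)
  qed
  then show "?d \<notin> {1, 2, 3}" by auto
qed (simp_all add: gauss_group_iso_integer_group)

end
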